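(* The online MSVV algorithm achieves ratio $1-\frac1e$ for the Adwords problem with the small-bids assumption. Precisely: for every $\delta>0$ there exists $\eta>0$ such that, for every instance of the Adwords problem with all budgets $B_u=1$ and all bids satisfying $0\le w_{uv}\le\eta$, and for every arrival order of the online vertices, the total revenue of the online MSVV algorithm is at least $\left(1-\frac1e-\delta\right)\mathrm{OPT}$, where $\mathrm{OPT}$ is the optimal value of the offline Adwords linear program.
   Context: Let $U$ (bidders) and $V$ (online vertices) be finite sets, with budgets $B_u=1$ for all $u$ (the paper's normalization) and bids $w_{uv}\ge0$. Offline Adwords linear program: maximize $\sum_{u,v}x_{uv}w_{uv}$ subject to $\sum_v x_{uv}w_{uv}\le B_u$ for all $u$, $\sum_u x_{uv}\le1$ for all $v$, and $x_{uv}\ge0$. Its optimal value is $\mathrm{OPT}$. Online problem: the vertices $v$ arrive one at a time. When $v$ arrives, its bids $(w_{uv})_u$ are revealed, and $v$ must be irrevocably matched to at most one bidder $u$. Matching $v$ to $u$ earns $\min(w_{uv},RB_u)$, where $RB_u$ is the remaining budget of $u$. A neighbor of $v$ is a bidder $u$ with $w_{uv}>0$. A bidder is available if its remaining budget is positive. Online MSVV algorithm: let $k=\frac{1}{1-1/e}$, let $x_u\in[0,1]$ be the fraction of the budget of $u$ spent so far, and let $\Delta_{uv}(x)=k e^{x-1}w_{uv}$. When $v$ arrives, if $v$ has no available neighbor, leave it unmatched. Otherwise match it to an available neighbor $u$ maximizing $k w_{uv}-\Delta_{uv}(x_u)=k w_{uv}\left(1-e^{x_u-1}\right)$, with ties broken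 arbitrarily. *)

theory Defs
  imports "HOL-Analysis.Analysis"
begin

text \<open>
  An instance consists of bidders \<open>U\<close>, online vertices \<open>V\<close>, budgets \<open>B\<close> and bids \<open>w u v\<close>; only
  the values of \<open>B\<close> on \<open>U\<close> and of \<open>w\<close> on \<open>U \<times> V\<close> matter.
\<close>

definition lp_feasible ::
  "'u set \<Rightarrow> 'v set \<Rightarrow> ('u \<Rightarrow> real) \<Rightarrow> ('u \<Rightarrow> 'v \<Rightarrow> real) \<Rightarrow> ('u \<Rightarrow> 'v \<Rightarrow> real) \<Rightarrow> bool" where
  "lp_feasible U V B w x \<longleftrightarrow>
     (\<forall>u\<in>U. (\<Sum>v\<in>V. x u v * w u v) \<le> B u) \<and>
     (\<forall>v\<in>V. (\<Sum>u\<in>U. x u v) \<le> 1) \<and>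
     (\<forall>u\<in>U. \<forall>v\<in>V. 0 \<le> x u v)"

definition lp_value :: "'u set \<Rightarrow> 'v set \<Rightarrow> ('u \<Rightarrow> 'v \<Rightarrow> real) \<Rightarrow> ('u \<Rightarrow> 'v \<Rightarrow> real) \<Rightarrow> real" where
  "lp_value U V w x = (\<Sum>u\<in>U. \<Sum>v\<in>V. x u v * w u v)"

text \<open>
  For finite \<open>U\<close> and nonnegative budgets the supremum is over a nonempty set bounded above by the
  total budget.
\<close>

definition adwords_OPT ::
  "'u set \<Rightarrow> 'v set \<Rightarrow> ('u \<Rightarrow> real) \<Rightarrow> ('u \<Rightarrow> 'v \<Rightarrow> real) \<Rightarrow> real" where
  "adwords_OPT U V B w = (SUP x \<in> {x. lp_feasible U V B w x}. lp_value U V w x)"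

text \<open>
  The state of an online algorithm is the function \<open>s\<close> giving the amount spent so far by each
  bidder. A decision is \<open>None\<close> (leave the vertex unmatched) or \<open>Some u\<close>.
\<close>

definition remaining_budget :: "('u \<Rightarrow> real) \<Rightarrow> ('u \<Rightarrow> real) \<Rightarrow> 'u \<Rightarrow> real" where
  "remaining_budget B s u = B u - s u"

fun earning ::
  "('u \<Rightarrow> real) \<Rightarrow> ('u \<Rightarrow> 'v \<Rightarrow> real) \<Rightarrow> ('u \<Rightarrow> real) \<Rightarrow> 'v \<Rightarrow> 'u option \<Rightarrow> real" where
  "earning B w s v None = 0"
| "earning B w s v (Some u) = min (w u v) (remaining_budget B s u)"

fun spend ::
  "('u \<Rightarrow> real) \<Rightarrow> ('u \<Rightarrow> 'v \<Rightarrow> real) \<Rightarrow> ('u \<Rightarrow> real) \<Rightarrow> 'v \<Rightarrow> 'u option \<Rightarrow> 'u \<Rightarrow> real" where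
  "spend B w s v None = s"
| "spend B w s v (Some u) = s(u := s u + earning B w s v (Some u))"

definition available_neighbors ::
  "'u set \<Rightarrow> ('u \<Rightarrow> real) \<Rightarrow> ('u \<Rightarrow> 'v \<Rightarrow> real) \<Rightarrow> ('u \<Rightarrow> real) \<Rightarrow> 'v \<Rightarrow> 'u set" where
  "available_neighbors U B w s v = {u \<in> U. w u v > 0 \<and> remaining_budget B s u > 0}"

definition msvv_k :: real where
  "msvv_k = 1 / (1 - 1 / exp 1)"

definition msvv_Delta :: "('u \<Rightarrow> 'v \<Rightarrow> real) \<Rightarrow> 'u \<Rightarrow> 'v \<Rightarrow> real \<Rightarrow> real" where
  "msvv_Delta w u v x = msvv_k * exp (x - 1) * w u v"

definition msvv_score ::
  "('u \<Rightarrow> real) \<Rightarrow> ('u \<Rightarrow> 'v \<Rightarrow> real) \<Rightarrow> ('u \<Rightarrow> real) \<Rightarrow> 'v \<Rightarrow> 'u \<Rightarrow> real" where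
  "msvv_score B w s v u = msvv_k * w u v - msvv_Delta w u v (s u / B u)"

fun msvv_choice ::
  "'u set \<Rightarrow> ('u \<Rightarrow> real) \<Rightarrow> ('u \<Rightarrow> 'v \<Rightarrow> real) \<Rightarrow> ('u \<Rightarrow> real) \<Rightarrow> 'v \<Rightarrow> 'u option \<Rightarrow> bool" where
  "msvv_choice U B w s v None \<longleftrightarrow> available_neighbors U B w s v = {}"
| "msvv_choice U B w s v (Some u) \<longleftrightarrow>
     is_arg_max (msvv_score B w s v) (\<lambda>u'. u' \<in> available_neighbors U B w s v) u"

text \<open>
  \<open>msvv_run U B w vs s r\<close>: for some way of breaking ties, processing the arrivals \<open>vs\<close> (first
  element first) ends with spending \<open>s\<close> and total revenue \<open>r\<close>.
\<close>

inductive msvv_run ::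
  "'u set \<Rightarrow> ('u \<Rightarrow> real) \<Rightarrow> ('u \<Rightarrow> 'v \<Rightarrow> real) \<Rightarrow> 'v list \<Rightarrow> ('u \<Rightarrow> real) \<Rightarrow> real \<Rightarrow> bool"
  for U B w where
  start: "msvv_run U B w [] (\<lambda>_. 0) 0"
| arrive: "msvv_run U B w (vs @ [v]) (spend B w s v d) (r + earning B w s v d)"
    if "msvv_run U B w vs s r" and "msvv_choice U B w s v d"

end

theory Submission
  imports Defs
begin

text \<open>
  The proof is primal-dual. The dual of the offline linear program asks for prices \<open>y u \<ge> 0\<close> and
  \<open>z v \<ge> 0\<close> with \<open>w u v * y u + z v \<ge> w u v\<close>, and minimises \<open>\<Sum>u. B u * y u + \<Sum>v. z v\<close>; every dual
  solution bounds OPT from above (\<open>adwords_OPT_le_dual\<close>).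

  The algorithm maintains a dual solution. The function \<open>price x = (e^x - 1) / (e - 1)\<close> increases
  from \<open>0\<close> to \<open>1\<close> on \<open>[0, 1]\<close>, and the quantity that MSVV maximises is exactly
  \<open>w u v * (1 - price (s u))\<close>. Put \<open>y u = price (s u)\<close> for the current spending \<open>s u\<close>, and let \<open>z v\<close>
  be the maximal score when \<open>v\<close> arrives (\<open>0\<close> if nobody is available). Then the constraint for
  \<open>(u, v)\<close> holds on arrival of \<open>v\<close>: either \<open>u\<close> was available and \<open>z v\<close> is at least its score, or the
  budget of \<open>u\<close> is exhausted and \<open>y u = 1\<close>. It keeps holding, since \<open>y u\<close> only grows.

  What makes the ratio come out is the differential equation \<open>price' = price + 1 / (e - 1)\<close>: an
  infinitesimal bid \<open>b\<close> raises the dual objective by \<open>b * price' + b * (1 - price) = b * k\<close>, with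
  \<open>k = 1 / (1 - 1/e)\<close>, whatever the state. For bids up to \<open>\<eta>\<close> the increase is at most \<open>e^\<eta> * k\<close>
  times the revenue earned (\<open>price_step\<close>). This also covers a last bid that is cut off by the remaining
  budget \<open>1 - x\<close>: its score is small too, because \<open>1 - price x \<le> k * (1 - x)\<close>. Hence
  \<open>OPT \<le> k * e^\<eta> * r\<close>, and \<open>\<eta> = \<delta>\<close> suffices: with \<open>1 / k = 1 - 1/e\<close> and \<open>e^(-\<delta>) \<ge> 1 - \<delta>\<close>,
  the ratio is at least \<open>(1 - 1/e) * (1 - \<delta>) \<ge> 1 - 1/e - \<delta>\<close>.
\<close>

section \<open>Weak duality\<close>

lemma lp_value_le_dual:
  assumes x: "lp_feasible U V B w x"
    and y: "\<And>u. u \<in> U \<Longrightarrow> 0 \<le> y u" and z: "\<And>v. v \<in> V \<Longrightarrow> 0 \<le> z v"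
    and dual: "\<And>u v. u \<in> U \<Longrightarrow> v \<in> V \<Longrightarrow> w u v \<le> w u v * y u + z v"
  shows "lp_value U V w x \<le> (\<Sum>u\<in>U. B u * y u) + (\<Sum>v\<in>V. z v)"
proof -
  have "lp_value U V w x \<le> (\<Sum>u\<in>U. \<Sum>v\<in>V. x u v * (w u v * y u + z v))"
    unfolding lp_value_def using x dual
    by (intro sum_mono mult_left_mono) (auto simp: lp_feasible_def)
  also have "\<dots> = (\<Sum>u\<in>U. (\<Sum>v\<in>V. x u v * w u v) * y u) + (\<Sum>u\<in>U. \<Sum>v\<in>V. x u v * z v)"
    by (simp add: distrib_left sum.distrib sum_distrib_right mult.assoc)
  also have "(\<Sum>u\<in>U. \<Sum>v\<in>V. x u v * z v) = (\<Sum>v\<in>V. (\<Sum>u\<in>U. x u v) * z v)"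
    by (subst sum.swap) (simp add: sum_distrib_right)
  also have "(\<Sum>u\<in>U. (\<Sum>v\<in>V. x u v * w u v) * y u) \<le> (\<Sum>u\<in>U. B u * y u)"
    using x y by (intro sum_mono mult_right_mono) (auto simp: lp_feasible_def)
  also have "(\<Sum>v\<in>V. (\<Sum>u\<in>U. x u v) * z v) \<le> (\<Sum>v\<in>V. 1 * z v)"
    using x z by (intro sum_mono mult_right_mono) (auto simp: lp_feasible_def)
  finally show ?thesis by simp
qed

lemma lp_feasible_zero:
  assumes "\<And>u. u \<in> U \<Longrightarrow> 0 \<le> B u"
  shows "lp_feasible U V B w (\<lambda>_ _. 0)"
  using assms by (simp add: lp_feasible_def)

lemma adwords_OPT_le_dual:
  assumes B: "\<And>u. u \<in> U \<Longrightarrow> 0 \<le> B u"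
    and y: "\<And>u. u \<in> U \<Longrightarrow> 0 \<le> y u" and z: "\<And>v. v \<in> V \<Longrightarrow> 0 \<le> z v"
    and dual: "\<And>u v. u \<in> U \<Longrightarrow> v \<in> V \<Longrightarrow> w u v \<le> w u v * y u + z v"
  shows "adwords_OPT U V B w \<le> (\<Sum>u\<in>U. B u * y u) + (\<Sum>v\<in>V. z v)"
  unfolding adwords_OPT_def
proof (rule cSUP_least)
  show "{x. lp_feasible U V B w x} \<noteq> {}"
    using lp_feasible_zero[of U B V w] B by blast
qed (use lp_value_le_dual[OF _ y z dual] in simp)

text \<open>
  The zero assignment is feasible. That the supremum dominates its value needs boundedness, which
  comes from the dual solution \<open>y = 1\<close>, \<open>z = 0\<close>.
\<close>
lemma adwords_OPT_nonneg:
  assumes B: "\<And>u. u \<in> U \<Longrightarrow> 0 \<le> B u"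
  shows "0 \<le> adwords_OPT U V B w"
proof -
  have "lp_value U V w x \<le> (\<Sum>u\<in>U. B u)" if "lp_feasible U V B w x" for x
    using lp_value_le_dual[OF that, of "\<lambda>_. 1" "\<lambda>_. 0"] by simp
  then have "bdd_above (lp_value U V w ` {x. lp_feasible U V B w x})"
    by (intro bdd_aboveI2) auto
  then have "lp_value U V w (\<lambda>_ _. 0) \<le> adwords_OPT U V B w"
    unfolding adwords_OPT_def using lp_feasible_zero[OF B] by (intro cSUP_upper) auto
  then show ?thesis by (simp add: lp_value_def)
qed

section \<open>The price function\<close>

definition price :: "real \<Rightarrow> real" where
  "price x = (exp x - 1) / (exp 1 - 1)"

lemma price_0 [simp]: "price 0 = 0"
  by (simp add: price_def)

lemma price_1 [simp]: "price 1 = 1"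
  by (simp add: price_def)

lemma price_mono: "x \<le> y \<Longrightarrow> price x \<le> price y"
  by (simp add: price_def divide_right_mono)

lemma price_nonneg: "0 \<le> x \<Longrightarrow> 0 \<le> price x"
  using price_mono[of 0 x] by simp

lemma price_le_1: "x \<le> 1 \<Longrightarrow> price x \<le> 1"
  using price_mono[of x 1] by simp

lemma price_diff: "price y - price x = (exp y - exp x) / (exp 1 - 1)"
  by (simp add: price_def flip: diff_divide_distrib)

lemma one_minus_price: "1 - price x = (exp 1 - exp x) / (exp 1 - 1)"
  using price_diff[of 1 x] by simp

lemma msvv_k_eq: "msvv_k = exp 1 / (exp 1 - 1)"
  by (simp add: msvv_k_def field_simps)

lemma msvv_score_eq_price: "msvv_score B w s v u = w u v * (1 - price (s u / B u))"
proof -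
  have "msvv_k * exp (s u / B u - 1) = exp (s u / B u) / (exp 1 - 1)"
    by (simp add: msvv_k_eq exp_diff)
  then have "msvv_score B w s v u = (exp 1 / (exp 1 - 1) - exp (s u / B u) / (exp 1 - 1)) * w u v"
    unfolding msvv_score_def msvv_Delta_def by (simp only: msvv_k_eq left_diff_distrib)
  then show ?thesis
    by (simp add: one_minus_price mult.commute flip: diff_divide_distrib)
qed

text \<open>
  The left-hand side is the increase of the dual objective when a bid \<open>b\<close> goes to a bidder who has
  spent \<open>x\<close>. Multiplied by \<open>e - 1\<close>, both cases rest on the tangent bound \<open>1 + t \<le> e^t\<close>; they differ
  in whether the bid fits into the remaining budget.
\<close>
lemma price_step:
  assumes b: "0 \<le> b" "b \<le> \<eta>" and x: "x \<le> 1"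
  defines "a \<equiv> min b (1 - x)"
  shows "price (x + a) - price x + b * (1 - price x) \<le> msvv_k * exp \<eta> * a"
proof -
  have e: "exp (1::real) - 1 > 0" by simp
  have "exp (x + a) - exp x + b * (exp 1 - exp x) \<le> exp 1 * exp b * a"
  proof (cases "b \<le> 1 - x")
    case True
    then have a: "a = b" by (simp add: a_def)
    have "exp (x + b) * (1 - b) \<le> exp (x + b) * exp (- b)"
      using exp_ge_add_one_self[of "- b"] by (intro mult_left_mono) auto
    also have "\<dots> = exp x" by (simp flip: exp_add)
    finally have growth: "exp (x + b) - exp x \<le> b * exp (x + b)"
      by (simp add: algebra_simps)
    have "b * ((exp b - 1) * exp x) \<le> b * ((exp b - 1) * exp 1)"
      using b x by (intro mult_left_mono) auto
    with growth show ?thesis by (simp add: a exp_add algebra_simps)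
  next
    case False
    then have a: "a = 1 - x" by (simp add: a_def)
    have "exp 1 * x \<le> exp 1 * exp (x - 1)"
      using exp_ge_add_one_self[of "x - 1"] by (intro mult_left_mono) auto
    also have "\<dots> = exp x" by (simp flip: exp_add)
    finally have "(1 + b) * (exp 1 - exp x) \<le> (1 + b) * (exp 1 * a)"
      using b by (intro mult_left_mono) (auto simp: a algebra_simps)
    also have "\<dots> \<le> exp b * (exp 1 * a)"
      using exp_ge_add_one_self[of b] x by (intro mult_right_mono) (auto simp: a)
    finally show ?thesis by (simp add: a algebra_simps)
  qed
  also have "\<dots> \<le> exp 1 * exp \<eta> * a"
    using b x by (intro mult_right_mono mult_left_mono) (auto simp: a_def)
  finally have "(exp (x + a) - exp x + b * (exp 1 - exp x)) / (exp 1 - 1)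
      \<le> exp 1 * exp \<eta> * a / (exp 1 - 1)"
    using e by (intro divide_right_mono) auto
  moreover have "(exp (x + a) - exp x + b * (exp 1 - exp x)) / (exp 1 - 1)
      = price (x + a) - price x + b * (1 - price x)"
    by (simp add: price_diff one_minus_price add_divide_distrib)
  ultimately show ?thesis by (simp add: msvv_k_eq)
qed

section \<open>The dual solution maintained by the algorithm\<close>

text \<open>
  The dual variables of the arrived vertices are constructed along the run. Those of the bidders are
  a function of the current spending, so the objective on the left is that of a dual solution for
  the instance restricted to \<open>set vs\<close>.
\<close>
lemma msvv_run_dual:
  assumes run: "msvv_run U B w vs s r"
    and "finite U" and B: "\<And>u. u \<in> U \<Longrightarrow> B u = 1"
    and bids: "\<And>u v. u \<in> U \<Longrightarrow> v \<in> set vs \<Longrightarrow> 0 \<le> w u v \<and> w u v \<le> \<eta>"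
    and "distinct vs"
  shows "(\<forall>u\<in>U. 0 \<le> s u \<and> s u \<le> 1) \<and>
    (\<exists>z. (\<forall>v\<in>set vs. 0 \<le> z v) \<and>
         (\<forall>u\<in>U. \<forall>v\<in>set vs. w u v \<le> w u v * price (s u) + z v) \<and>
         (\<Sum>u\<in>U. price (s u)) + (\<Sum>v\<in>set vs. z v) \<le> msvv_k * exp \<eta> * r)"
  using run bids \<open>distinct vs\<close>
proof (induction rule: msvv_run.induct)
  case start
  then show ?case by simp
next
  case (arrive vs s r v d)
  have new: "v \<notin> set vs" using arrive.prems by simp
  have bid: "0 \<le> w u v" "w u v \<le> \<eta>" if "u \<in> U" for u
    using arrive.prems(1)[of u v] that by auto
  have "distinct vs" and "\<And>u v. u \<in> U \<Longrightarrow> v \<in> set vs \<Longrightarrow> 0 \<le> w u v \<and> w u v \<le> \<eta>"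
    using arrive.prems by auto
  from arrive.IH[OF this(2,1)] obtain z where s: "\<And>u. u \<in> U \<Longrightarrow> 0 \<le> s u \<and> s u \<le> 1"
    and z: "\<And>v. v \<in> set vs \<Longrightarrow> 0 \<le> z v"
    and dual: "\<And>u v. u \<in> U \<Longrightarrow> v \<in> set vs \<Longrightarrow> w u v \<le> w u v * price (s u) + z v"
    and obj: "(\<Sum>u\<in>U. price (s u)) + (\<Sum>v\<in>set vs. z v) \<le> msvv_k * exp \<eta> * r"
    by blast
  let ?s = "spend B w s v d"
  define c where "c = (case d of None \<Rightarrow> 0 | Some u \<Rightarrow> w u v * (1 - price (s u)))"
  have avail: "u \<in> available_neighbors U B w s v \<longleftrightarrow> u \<in> U \<and> w u v > 0 \<and> s u < 1" for u
    using B by (auto simp: available_neighbors_def remaining_budget_def)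
  have score: "msvv_score B w s v u = w u v * (1 - price (s u))" if "u \<in> U" for u
    using B[OF that] by (simp add: msvv_score_eq_price)
  have chosen: "u \<in> U" "s u < 1" if "d = Some u" for u
    using arrive.hyps(2) that avail by (auto simp: is_arg_max_def)

  have c_nonneg: "0 \<le> c"
  proof (cases d)
    case (Some u)
    with chosen[of u] show ?thesis
      using bid[of u] price_le_1[of "s u"] by (simp add: c_def)
  qed (simp add: c_def)
  have c_max: "w u v * (1 - price (s u)) \<le> c" if u: "u \<in> U" for u
  proof (cases "u \<in> available_neighbors U B w s v")
    case True
    then obtain u' where d: "d = Some u'"
      using arrive.hyps(2) by (cases d) auto
    have "msvv_score B w s v u \<le> msvv_score B w s v u'"
      using arrive.hyps(2) True by (auto simp: d is_arg_max_linorder)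
    then show ?thesis using score u chosen(1)[OF d] by (simp add: c_def d)
  next
    case False
    then have "w u v = 0 \<or> s u = 1"
      using avail u bid(1)[OF u] s[OF u] by force
    then show ?thesis using c_nonneg by auto
  qed

  have s_new: "s u \<le> ?s u \<and> ?s u \<le> 1" if "u \<in> U" for u
    using s[OF that] bid(1)[OF that] B[OF that]
    by (cases d) (auto simp: remaining_budget_def)
  have step: "(\<Sum>u\<in>U. price (?s u)) + c
      \<le> (\<Sum>u\<in>U. price (s u)) + msvv_k * exp \<eta> * earning B w s v d"
  proof (cases d)
    case None
    then show ?thesis by (simp add: c_def)
  next
    case (Some u)
    note u = chosen[OF Some]
    have "price (?s u) - price (s u) + c \<le> msvv_k * exp \<eta> * earning B w s v d"
      using price_step[of "w u v" \<eta> "s u"] bid[OF u(1)] u B[OF u(1)]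
      by (simp add: Some c_def remaining_budget_def)
    moreover have "(\<Sum>u'\<in>U - {u}. price (?s u')) = (\<Sum>u'\<in>U - {u}. price (s u'))"
      by (intro sum.cong) (auto simp: Some)
    ultimately show ?thesis
      using sum.remove[OF \<open>finite U\<close> u(1), of "\<lambda>u. price (?s u)"]
        sum.remove[OF \<open>finite U\<close> u(1), of "\<lambda>u. price (s u)"] by linarith
  qed

  let ?z = "z(v := c)"
  have "0 \<le> ?s u \<and> ?s u \<le> 1" if "u \<in> U" for u
    using s[OF that] s_new[OF that] by linarith
  moreover have "0 \<le> ?z v'" if "v' \<in> set (vs @ [v])" for v'
    using that z c_nonneg by auto
  moreover have "w u v' \<le> w u v' * price (?s u) + ?z v'"
    if u: "u \<in> U" and v': "v' \<in> set (vs @ [v])" for u v'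
  proof -
    have "w u v' \<le> w u v' * price (s u) + ?z v'"
      using dual[OF u, of v'] c_max[OF u] v' by (auto simp: algebra_simps)
    moreover have "w u v' * price (s u) \<le> w u v' * price (?s u)"
      using arrive.prems(1)[OF u v'] s_new[OF u] by (intro mult_left_mono price_mono) auto
    ultimately show ?thesis by linarith
  qed
  moreover have "(\<Sum>u\<in>U. price (?s u)) + (\<Sum>v'\<in>set (vs @ [v]). ?z v')
      \<le> msvv_k * exp \<eta> * (r + earning B w s v d)"
  proof -
    have "(\<Sum>v'\<in>set vs. ?z v') = (\<Sum>v'\<in>set vs. z v')"
      using new by (intro sum.cong) auto
    then have "(\<Sum>v'\<in>set (vs @ [v]). ?z v') = c + (\<Sum>v'\<in>set vs. z v')"
      using new by simp
    then show ?thesis using step obj by (simp add: distrib_left)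
  qed
  ultimately show ?case by blast
qed

section \<open>The competitive ratio\<close>

lemma msvv_run_OPT_le:
  assumes run: "msvv_run U B w vs s r"
    and "finite U" and B: "\<And>u. u \<in> U \<Longrightarrow> B u = 1"
    and bids: "\<And>u v. u \<in> U \<Longrightarrow> v \<in> set vs \<Longrightarrow> 0 \<le> w u v \<and> w u v \<le> \<eta>"
    and "distinct vs"
  shows "adwords_OPT U (set vs) B w \<le> msvv_k * exp \<eta> * r"
proof -
  obtain z where s: "\<forall>u\<in>U. 0 \<le> s u \<and> s u \<le> 1" and z: "\<forall>v\<in>set vs. 0 \<le> z v"
    and dual: "\<forall>u\<in>U. \<forall>v\<in>set vs. w u v \<le> w u v * price (s u) + z v"
    and obj: "(\<Sum>u\<in>U. price (s u)) + (\<Sum>v\<in>set vs. z v) \<le> msvv_k * exp \<eta> * r"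
    using msvv_run_dual[OF assms] by blast
  have "adwords_OPT U (set vs) B w \<le> (\<Sum>u\<in>U. B u * price (s u)) + (\<Sum>v\<in>set vs. z v)"
    using s z dual B by (intro adwords_OPT_le_dual) (auto intro: price_nonneg)
  with obj B show ?thesis by simp
qed

theorem theorem3:
  fixes \<delta> :: real
  assumes "\<delta> > 0"
  shows "\<exists>\<eta>>0. \<forall>(U :: 'u set) (V :: 'v set) (B :: 'u \<Rightarrow> real) (w :: 'u \<Rightarrow> 'v \<Rightarrow> real)
            (vs :: 'v list) (s :: 'u \<Rightarrow> real) (r :: real).
          finite U \<longrightarrow> finite V \<longrightarrow>
          (\<forall>u\<in>U. B u = 1) \<longrightarrow>
          (\<forall>u\<in>U. \<forall>v\<in>V. 0 \<le> w u v \<and> w u v \<le> \<eta>) \<longrightarrow>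
          distinct vs \<longrightarrow> set vs = V \<longrightarrow>
          msvv_run U B w vs s r \<longrightarrow>
          r \<ge> (1 - 1 / exp 1 - \<delta>) * adwords_OPT U V B w"
proof (intro exI[of _ \<delta>] conjI allI impI)
  fix U :: "'u set" and V :: "'v set" and B w and vs :: "'v list" and s and r :: real
  assume "finite U" "\<forall>u\<in>U. B u = 1" "\<forall>u\<in>U. \<forall>v\<in>V. 0 \<le> w u v \<and> w u v \<le> \<delta>"
    "distinct vs" "set vs = V" "msvv_run U B w vs s r"
  then have OPT: "adwords_OPT U V B w \<le> msvv_k * exp \<delta> * r" and OPT0: "0 \<le> adwords_OPT U V B w"
    using msvv_run_OPT_le[of U B w vs s r \<delta>] adwords_OPT_nonneg[of U B V w] by auto
  define q :: real where "q = 1 - 1 / exp 1"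
  have q: "0 < q" "q \<le> 1" "msvv_k = 1 / q" by (auto simp: q_def msvv_k_def)
  have "q - \<delta> \<le> q * (1 - \<delta>)"
    using q assms mult_right_mono[of q 1 \<delta>] by (simp add: algebra_simps)
  also have "\<dots> \<le> q * exp (- \<delta>)"
    using q exp_ge_add_one_self[of "- \<delta>"] by (intro mult_left_mono) auto
  finally have "(q - \<delta>) * adwords_OPT U V B w \<le> q * exp (- \<delta>) * adwords_OPT U V B w"
    using OPT0 by (intro mult_right_mono)
  also have "\<dots> \<le> q * exp (- \<delta>) * (msvv_k * exp \<delta> * r)"
    using OPT q by (intro mult_left_mono) auto
  also have "\<dots> = r" using q by (simp add: exp_minus field_simps)
  finally show "r \<ge> (1 - 1 / exp 1 - \<delta>) * adwords_OPT U V B w" by (simp add: q_def)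
qed (rule assms)

end
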